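(* Let $A=A^\top\in\mathbb{R}^{n\times n}$ be the adjacency matrix of an undirected, possibly weighted graph on $n$ vertices (nonnegative weights, not assumed connected), with nonsingular diagonal degree matrix $D$, and let $L=I-\alpha D^{-1}A$. Let $\widetilde{\Omega}$ be a subset of the vertices with indicator vector $\mathbf{1}_{\widetilde{\Omega}}$, and let $$\rho := \frac{\mathbf{1}_{\widetilde{\Omega}}^\top D\,\mathbf{1}_{\widetilde{\Omega}}}{\mathbf{1}^\top D\,\mathbf{1}}.$$ Suppose that $0<\alpha<1$ and $0<\rho<1$. If $Lx=b$ with $b=\mathbf{1}-\mathbf{1}_{\widetilde{\Omega}}$, then the data-dependent condition number satisfies $$\kappa_D(L,\mathbf{1}-\mathbf{1}_{\widetilde{\Omega}})\leqslant\begin{cases}\sqrt{5} & \text{if } \rho\leqslant(1-\alpha)^2,\\[2pt] \sqrt{1+(1+\alpha)^2/(1-\alpha)^2} & \text{if } \rho>(1-\alpha)^2.\end{cases}$$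
   Context: $D$ is the diagonal matrix whose $i$th diagonal entry is the $i$th row sum of $A$; it is assumed nonsingular (isolated vertices carry a self-loop), so all degrees are positive and $D^{-1}A$ is row-stochastic. $\mathbf{1}\in\mathbb{R}^n$ is the vector of all ones, and $\mathbf{1}_{\widetilde{\Omega}}$ has entry $1$ at vertices of $\widetilde{\Omega}$ and $0$ elsewhere. The $D$-norm is $\|v\|_D=\sqrt{v^\top D v}$. For $0<\alpha<1$ the matrix $L$ is invertible. For nonzero $x\in\mathbb{R}^n$, write $x=\mathbf{1}\gamma+w$ with $\gamma\in\mathbb{R}$ and $w^\top D\mathbf{1}=0$; then $\cos_D\angle(x,\mathbf{1})=\|\mathbf{1}\gamma\|_D/\|x\|_D$ and $\sin_D\angle(x,\mathbf{1})=\|w\|_D/\|x\|_D$. For nonzero $b=Lx$, the data-dependent condition number is $$\kappa_D(L,b) := \sqrt{\cos_D^2\angle(x,\mathbf{1})+\sin_D^2\angle(x,\mathbf{1})\Big(\frac{1+\alpha}{1-\alpha}\Big)^2}.$$ *)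

theory Defs
  imports "HOL-Analysis.Analysis"
begin

definition degree_matrix :: "real ^ 'n ^ 'n \<Rightarrow> real ^ 'n ^ 'n" where
  "degree_matrix A = (\<chi> i j. if i = j then (\<Sum>k\<in>UNIV. A $ i $ k) else 0)"

definition L_matrix :: "real ^ 'n ^ 'n \<Rightarrow> real \<Rightarrow> real ^ 'n ^ 'n" where
  "L_matrix A \<alpha> = mat 1 - \<alpha> *\<^sub>R (matrix_inv (degree_matrix A) ** A)"

definition ind_vec :: "'n set \<Rightarrow> real ^ 'n" where
  "ind_vec S = (\<chi> i. if i \<in> S then 1 else 0)"

definition ones :: "real ^ 'n" where
  "ones = (\<chi> i. 1)"

definition rho :: "real ^ 'n ^ 'n \<Rightarrow> 'n set \<Rightarrow> real" where
  "rho A S = (ind_vec S \<bullet> (degree_matrix A *v ind_vec S)) / (ones \<bullet> (degree_matrix A *v ones))"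

definition norm_D :: "real ^ 'n ^ 'n \<Rightarrow> real ^ 'n \<Rightarrow> real" where
  "norm_D D v = sqrt (v \<bullet> (D *v v))"

(* The coefficient \<gamma> in the D-orthogonal splitting x = \<gamma> 1 + w; it is
   well defined as soon as 1\<^sup>T D 1 is nonzero, see coeff_D_eq below. *)
definition coeff_D :: "real ^ 'n ^ 'n \<Rightarrow> real ^ 'n \<Rightarrow> real" where
  "coeff_D D x = (THE \<gamma>. \<exists>w. x = \<gamma> *\<^sub>R ones + w \<and> w \<bullet> (D *v ones) = 0)"

definition cos_D :: "real ^ 'n ^ 'n \<Rightarrow> real ^ 'n \<Rightarrow> real" where
  "cos_D D x = norm_D D (coeff_D D x *\<^sub>R ones) / norm_D D x"

definition sin_D :: "real ^ 'n ^ 'n \<Rightarrow> real ^ 'n \<Rightarrow> real" where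
  "sin_D D x = norm_D D (x - coeff_D D x *\<^sub>R ones) / norm_D D x"

(* The vector x is the solution of L x = b, so the value is meaningful only for
   invertible L and nonzero b. *)
definition kappa_D :: "real ^ 'n ^ 'n \<Rightarrow> real \<Rightarrow> real ^ 'n ^ 'n \<Rightarrow> real ^ 'n \<Rightarrow> real" where
  "kappa_D D \<alpha> L b =
    (let x = (THE x. L *v x = b)
     in sqrt ((cos_D D x)\<^sup>2 + (sin_D D x)\<^sup>2 * ((1 + \<alpha>) / (1 - \<alpha>))\<^sup>2))"

lemma coeff_D_eq:
  fixes D :: "real ^ 'n ^ 'n"
  assumes "ones \<bullet> (D *v ones) \<noteq> 0"
  shows "coeff_D D x = x \<bullet> (D *v ones) / (ones \<bullet> (D *v ones))"
  unfolding coeff_D_def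
proof (rule the_equality)
  let ?c = "x \<bullet> (D *v ones) / (ones \<bullet> (D *v ones))"
  have "(x - ?c *\<^sub>R ones) \<bullet> (D *v ones) = 0"
    using assms by (simp add: inner_diff_left)
  then show "\<exists>w. x = ?c *\<^sub>R ones + w \<and> w \<bullet> (D *v ones) = 0"
    by (intro exI[of _ "x - ?c *\<^sub>R ones"]) simp
next
  fix \<gamma>
  assume "\<exists>w. x = \<gamma> *\<^sub>R ones + w \<and> w \<bullet> (D *v ones) = 0"
  then show "\<gamma> = x \<bullet> (D *v ones) / (ones \<bullet> (D *v ones))"
    using assms by (auto simp: inner_add_left)
qed

end

theory Submission
  imports Defs
begin

text \<open>
  In the \<open>D\<close>-inner product the splitting \<open>b = (1 - \<rho>) \<one> + u\<close> of the right-hand side has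
  \<open>\<parallel>u\<parallel>\<^sup>2 = \<rho> (1 - \<rho>) \<parallel>\<one>\<parallel>\<^sup>2\<close>. Since \<open>L \<one> = (1 - \<alpha>) \<one>\<close>, the solution is
  \<open>x = \<gamma> \<one> + w\<close> with \<open>\<gamma> = (1 - \<rho>) / (1 - \<alpha>)\<close> and \<open>L w = u\<close>, and coercivity of \<open>L\<close> with
  constant \<open>1 - \<alpha>\<close> bounds \<open>\<parallel>w\<parallel> \<le> \<parallel>u\<parallel> / (1 - \<alpha>)\<close>. Hence \<open>sin\<^sup>2 \<le> \<rho>\<close>, and \<open>\<rho> \<le> (1 - \<alpha>)\<^sup>2\<close>
  makes the sine term of \<open>\<kappa>\<^sup>2\<close> at most \<open>(1 + \<alpha>)\<^sup>2 \<le> 4\<close>.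
\<close>

section \<open>The degree matrix and the inner product it induces\<close>

lemma degree_matrix_mult_nth:
  fixes A :: "real ^ 'n ^ 'n"
  shows "(degree_matrix A *v x) $ i = (\<Sum>k\<in>UNIV. A $ i $ k) * x $ i"
  by (simp add: matrix_vector_mult_def degree_matrix_def if_distrib[of "\<lambda>t. t * _"] cong: if_cong)

lemma degree_matrix_mult_ones:
  fixes A :: "real ^ 'n ^ 'n"
  shows "degree_matrix A *v ones = A *v ones"
  unfolding vec_eq_iff degree_matrix_mult_nth
  by (simp add: matrix_vector_mult_def ones_def)

lemma inner_degree_matrix:
  fixes A :: "real ^ 'n ^ 'n"
  shows "x \<bullet> (degree_matrix A *v y) = (\<Sum>i\<in>UNIV. (\<Sum>k\<in>UNIV. A $ i $ k) * (x $ i * y $ i))"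
  by (simp add: inner_vec_def degree_matrix_mult_nth mult_ac)

lemma inner_degree_matrix_commute:
  fixes A :: "real ^ 'n ^ 'n"
  shows "x \<bullet> (degree_matrix A *v y) = y \<bullet> (degree_matrix A *v x)"
  by (simp add: inner_degree_matrix mult_ac)

text \<open>A zero degree would make a row of \<open>degree_matrix A\<close> vanish and hence its
  determinant; nonnegative weights exclude negative degrees.\<close>

lemma degree_pos:
  fixes A :: "real ^ 'n ^ 'n"
  assumes "\<And>i j. 0 \<le> A $ i $ j" and "invertible (degree_matrix A)"
  shows "0 < (\<Sum>k\<in>UNIV. A $ i $ k)"
proof -
  have "(\<Sum>k\<in>UNIV. A $ i $ k) \<noteq> 0"
  proof
    assume "(\<Sum>k\<in>UNIV. A $ i $ k) = 0"
    then have "row i (degree_matrix A) = 0"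
      by (simp add: vec_eq_iff row_def degree_matrix_def)
    then have "det (degree_matrix A) = 0"
      by (rule det_zero_row)
    with assms(2) show False
      by (simp add: invertible_det_nz)
  qed
  moreover have "0 \<le> (\<Sum>k\<in>UNIV. A $ i $ k)"
    by (simp add: assms(1) sum_nonneg)
  ultimately show ?thesis by simp
qed

lemma inner_degree_matrix_nonneg:
  fixes A :: "real ^ 'n ^ 'n"
  assumes "\<And>i j. 0 \<le> A $ i $ j"
  shows "0 \<le> z \<bullet> (degree_matrix A *v z)"
  by (simp add: inner_degree_matrix assms sum_nonneg)

text \<open>The form is a sum of squares weighted by positive degrees, so it vanishes only if every
  entry does. This definiteness makes it an inner product.\<close>

lemma inner_degree_matrix_eq_0:
  fixes A :: "real ^ 'n ^ 'n"
  assumes "\<And>i j. 0 \<le> A $ i $ j" and "invertible (degree_matrix A)"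
    and "z \<bullet> (degree_matrix A *v z) = 0"
  shows "z = 0"
proof -
  have pos: "0 < (\<Sum>k\<in>UNIV. A $ i $ k)" for i
    using assms(1,2) by (rule degree_pos)
  have "\<forall>i\<in>UNIV. (\<Sum>k\<in>UNIV. A $ i $ k) * (z $ i * z $ i) = 0"
    using assms(3) unfolding inner_degree_matrix
    by (subst (asm) sum_nonneg_eq_0_iff) (simp_all add: less_imp_le[OF pos])
  then show ?thesis
    using pos by (simp add: vec_eq_iff less_imp_neq[symmetric])
qed

text \<open>The difference of the two sides is half of \<open>\<Sum>\<^sub>i\<^sub>j A\<^sub>i\<^sub>j (z\<^sub>i - z\<^sub>j)\<^sup>2\<close>.\<close>
lemma inner_adjacency_le_degree:
  fixes A :: "real ^ 'n ^ 'n"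
  assumes "transpose A = A" and "\<And>i j. 0 \<le> A $ i $ j"
  shows "z \<bullet> (A *v z) \<le> z \<bullet> (degree_matrix A *v z)"
proof -
  have sym: "A $ i $ j = A $ j $ i" for i j
    by (metis assms(1) transpose_def vec_lambda_beta)
  have D: "z \<bullet> (degree_matrix A *v z) = (\<Sum>i\<in>UNIV. \<Sum>j\<in>UNIV. A $ i $ j * (z $ i)\<^sup>2)"
    by (simp add: inner_degree_matrix sum_distrib_right power2_eq_square)
  then have D': "z \<bullet> (degree_matrix A *v z) = (\<Sum>i\<in>UNIV. \<Sum>j\<in>UNIV. A $ i $ j * (z $ j)\<^sup>2)"
    by (subst sum.swap) (simp add: sym)
  have A: "z \<bullet> (A *v z) = (\<Sum>i\<in>UNIV. \<Sum>j\<in>UNIV. A $ i $ j * (z $ i * z $ j))"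
    by (simp add: inner_vec_def matrix_vector_mult_def sum_distrib_left mult_ac)
  have "0 \<le> (\<Sum>i\<in>UNIV. \<Sum>j\<in>UNIV. A $ i $ j * (z $ i - z $ j)\<^sup>2)"
    by (simp add: assms(2) sum_nonneg)
  also have "\<dots> = (\<Sum>i\<in>UNIV. \<Sum>j\<in>UNIV. A $ i $ j * (z $ i)\<^sup>2 + A $ i $ j * (z $ j)\<^sup>2
      - 2 * (A $ i $ j * (z $ i * z $ j)))"
    by (simp add: power2_eq_square algebra_simps)
  also have "\<dots> = 2 * (z \<bullet> (degree_matrix A *v z)) - 2 * (z \<bullet> (A *v z))"
    by (simp add: sum.distrib sum_subtractf sum_distrib_left[symmetric] D[symmetric]
        D'[symmetric] A[symmetric])
  finally show ?thesis by simp
qed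

section \<open>Coercivity and injectivity of \<open>L\<close>\<close>

lemma matrix_mult_inv:
  fixes M :: "'a::semiring_1 ^ 'n ^ 'm"
  assumes "invertible M"
  shows "M ** matrix_inv M = mat 1"
  using someI_ex[OF assms[unfolded invertible_def]] by (simp add: matrix_inv_def)

text \<open>Applying the degree matrix cancels the inverse inside \<open>L\<close>, so later
  computations involve only \<open>A\<close> and its degrees.\<close>

lemma degree_matrix_mult_L_matrix:
  fixes A :: "real ^ 'n ^ 'n"
  assumes "invertible (degree_matrix A)"
  shows "degree_matrix A *v (L_matrix A \<alpha> *v x) = degree_matrix A *v x - \<alpha> *\<^sub>R (A *v x)"
proof -
  have "degree_matrix A *v ((matrix_inv (degree_matrix A) ** A) *v x) = A *v x"
    by (simp add: matrix_vector_mul_assoc matrix_mul_assoc matrix_mult_inv[OF assms])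
  then show ?thesis
    by (simp add: L_matrix_def matrix_vector_mult_diff_rdistrib matrix_vector_mult_diff_distrib
        scaleR_matrix_vector_assoc[symmetric] matrix_vector_mult_scaleR)
qed

lemma L_matrix_coercive:
  fixes A :: "real ^ 'n ^ 'n"
  assumes "transpose A = A" and "\<And>i j. 0 \<le> A $ i $ j"
    and "invertible (degree_matrix A)" and "0 \<le> \<alpha>"
  shows "(1 - \<alpha>) * (z \<bullet> (degree_matrix A *v z)) \<le> z \<bullet> (degree_matrix A *v (L_matrix A \<alpha> *v z))"
proof -
  have "\<alpha> * (z \<bullet> (A *v z)) \<le> \<alpha> * (z \<bullet> (degree_matrix A *v z))"
    using assms(1,2,4) by (intro mult_left_mono inner_adjacency_le_degree)
  then show ?thesis
    by (simp add: degree_matrix_mult_L_matrix[OF assms(3)] inner_diff_right algebra_simps)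
qed

text \<open>Coercivity would give this through Cauchy-Schwarz; instead, with \<open>y = L z\<close>,
  the squared \<open>D\<close>-norm of \<open>y - (1 - \<alpha>) z\<close> is expanded and its mixed
  term bounded by coercivity.\<close>

lemma L_matrix_norm_lower_bound:
  fixes A :: "real ^ 'n ^ 'n"
  assumes "transpose A = A" and "\<And>i j. 0 \<le> A $ i $ j"
    and "invertible (degree_matrix A)" and "0 \<le> \<alpha>" and "\<alpha> \<le> 1"
  defines "D \<equiv> degree_matrix A"
  shows "(1 - \<alpha>)\<^sup>2 * (z \<bullet> (D *v z)) \<le> (L_matrix A \<alpha> *v z) \<bullet> (D *v (L_matrix A \<alpha> *v z))"
proof -
  define y where "y = L_matrix A \<alpha> *v z"
  have "(1 - \<alpha>) * ((1 - \<alpha>) * (z \<bullet> (D *v z))) \<le> (1 - \<alpha>) * (z \<bullet> (D *v y))"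
    using L_matrix_coercive[OF assms(1-4)] assms(5)
    by (intro mult_left_mono) (auto simp: D_def y_def)
  moreover have "0 \<le> (y - (1 - \<alpha>) *\<^sub>R z) \<bullet> (D *v (y - (1 - \<alpha>) *\<^sub>R z))"
    unfolding D_def using assms(2) by (rule inner_degree_matrix_nonneg)
  moreover have "y \<bullet> (D *v z) = z \<bullet> (D *v y)"
    unfolding D_def by (rule inner_degree_matrix_commute)
  ultimately show ?thesis
    unfolding y_def[symmetric]
    by (simp add: matrix_vector_mult_diff_distrib matrix_vector_mult_scaleR inner_diff_left
        inner_diff_right power2_eq_square algebra_simps)
qed

text \<open>Since \<open>1 - \<alpha>\<close> is positive, coercivity leaves only the zero vector in
  the kernel. This identifies the solution that \<open>kappa_D\<close> selects by
  \<open>THE\<close>.\<close>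

lemma L_matrix_inj:
  fixes A :: "real ^ 'n ^ 'n"
  assumes "transpose A = A" and "\<And>i j. 0 \<le> A $ i $ j"
    and "invertible (degree_matrix A)" and "0 \<le> \<alpha>" and "\<alpha> < 1"
    and "L_matrix A \<alpha> *v x = L_matrix A \<alpha> *v y"
  shows "x = y"
proof -
  define z where "z = x - y"
  have "L_matrix A \<alpha> *v z = 0"
    by (simp add: z_def matrix_vector_mult_diff_distrib assms(6))
  with L_matrix_coercive[OF assms(1-4), of z]
  have "(1 - \<alpha>) * (z \<bullet> (degree_matrix A *v z)) \<le> 0"
    by simp
  with assms(5) have "z \<bullet> (degree_matrix A *v z) \<le> 0"
    by (simp add: mult_le_0_iff)
  then have "z \<bullet> (degree_matrix A *v z) = 0"
    using inner_degree_matrix_nonneg[OF assms(2), where z = z] by simp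
  with assms(2,3) have "z = 0"
    by (rule inner_degree_matrix_eq_0)
  then show ?thesis by (simp add: z_def)
qed

section \<open>Angles to the constant vector in the \<open>D\<close>-norm\<close>

lemma norm_D_power2:
  assumes "0 \<le> v \<bullet> (D *v v)"
  shows "(norm_D D v)\<^sup>2 = v \<bullet> (D *v v)"
  using assms by (simp add: norm_D_def)

text \<open>Pythagoras for the \<open>D\<close>-orthogonal splitting of \<open>x\<close>; since
  \<open>x\<close> is nonzero, its \<open>D\<close>-norm can be divided out.\<close>

lemma cos_D_sin_D_power2:
  fixes A :: "real ^ 'n ^ 'n"
  assumes nonneg: "\<And>i j. 0 \<le> A $ i $ j" and inv: "invertible (degree_matrix A)"
    and "x \<noteq> 0"
  shows "(cos_D (degree_matrix A) x)\<^sup>2 + (sin_D (degree_matrix A) x)\<^sup>2 = 1"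
proof -
  define D where "D = degree_matrix A"
  define \<gamma> where "\<gamma> = coeff_D D x"
  define w where "w = x - \<gamma> *\<^sub>R ones"
  have E: "0 \<le> z \<bullet> (D *v z)" for z
    unfolding D_def using nonneg by (rule inner_degree_matrix_nonneg)
  have "(ones :: real ^ 'n) \<noteq> 0"
    by (simp add: ones_def vec_eq_iff)
  then have T: "ones \<bullet> (D *v ones) \<noteq> 0"
    using inner_degree_matrix_eq_0[OF nonneg inv] by (auto simp: D_def)
  have x: "x \<bullet> (D *v x) \<noteq> 0"
    using inner_degree_matrix_eq_0[OF nonneg inv] assms(3) by (auto simp: D_def)
  have w: "w \<bullet> (D *v ones) = 0"
    using T by (simp add: w_def \<gamma>_def coeff_D_eq[OF T] inner_diff_left)
  then have w': "ones \<bullet> (D *v w) = 0"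
    unfolding D_def by (subst inner_degree_matrix_commute)
  have x_eq: "x = \<gamma> *\<^sub>R ones + w"
    by (simp add: w_def)
  have "x \<bullet> (D *v x) = (\<gamma> *\<^sub>R ones) \<bullet> (D *v (\<gamma> *\<^sub>R ones)) + w \<bullet> (D *v w)"
    unfolding x_eq using w w'
    by (simp add: matrix_vector_right_distrib matrix_vector_mult_scaleR inner_add_left inner_add_right)
  moreover have "(cos_D D x)\<^sup>2 + (sin_D D x)\<^sup>2
      = ((\<gamma> *\<^sub>R ones) \<bullet> (D *v (\<gamma> *\<^sub>R ones)) + w \<bullet> (D *v w)) / (x \<bullet> (D *v x))"
    unfolding cos_D_def sin_D_def \<gamma>_def[symmetric] w_def[symmetric] power_divide
      norm_D_power2[OF E] by (rule add_divide_distrib[symmetric])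
  ultimately show ?thesis
    using x by (simp add: D_def)
qed

lemma sin_D_power2_le_rho:
  fixes A :: "real ^ 'n ^ 'n"
  assumes sym: "transpose A = A" and nonneg: "\<And>i j. 0 \<le> A $ i $ j"
    and inv: "invertible (degree_matrix A)" and "0 \<le> \<alpha>" and "\<alpha> < 1"
    and "rho A \<Omega> < 1"
    and Lx: "L_matrix A \<alpha> *v x = ones - ind_vec \<Omega>"
  shows "(sin_D (degree_matrix A) x)\<^sup>2 \<le> rho A \<Omega>"
proof -
  define D where "D = degree_matrix A"
  define T where "T = ones \<bullet> (D *v ones)"
  define r where "r = rho A \<Omega>"
  define \<gamma> where "\<gamma> = coeff_D D x"
  define w where "w = x - \<gamma> *\<^sub>R ones"
  define b where "b = ones - ind_vec \<Omega>"
  have comm: "y \<bullet> (D *v z) = z \<bullet> (D *v y)" for y z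
    unfolding D_def by (rule inner_degree_matrix_commute)
  have E: "0 \<le> z \<bullet> (D *v z)" for z
    unfolding D_def using nonneg by (rule inner_degree_matrix_nonneg)
  have "(ones :: real ^ 'n) \<noteq> 0"
    by (simp add: ones_def vec_eq_iff)
  then have "T \<noteq> 0"
    using inner_degree_matrix_eq_0[OF nonneg inv] by (auto simp: D_def T_def)
  with E have T: "0 < T"
    by (simp add: T_def order_less_le)
  have ind: "ind_vec \<Omega> \<bullet> (D *v ind_vec \<Omega>) = r * T"
    using \<open>T \<noteq> 0\<close> by (simp add: r_def rho_def T_def D_def)
  \<comment> \<open>The form is diagonal and the indicator has entries 0 and 1, so one of its two
    occurrences may be replaced by \<open>ones\<close>.\<close>
  have ones_ind: "ones \<bullet> (D *v ind_vec \<Omega>) = r * T"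
    unfolding ind[symmetric] D_def inner_degree_matrix
    by (rule sum.cong) (auto simp: ind_vec_def ones_def)
  have ind_ones: "ind_vec \<Omega> \<bullet> (D *v ones) = r * T"
    using ones_ind comm by metis
  have ones_b: "ones \<bullet> (D *v b) = (1 - r) * T"
    by (simp add: b_def matrix_vector_mult_diff_distrib inner_diff_right ones_ind T_def[symmetric]
        algebra_simps)
  have b_b: "b \<bullet> (D *v b) = (1 - r) * T"
    by (simp add: b_def matrix_vector_mult_diff_distrib inner_diff_right inner_diff_left ones_ind
        ind_ones ind T_def[symmetric] algebra_simps)
  have Lx': "L_matrix A \<alpha> *v x = b"
    by (simp add: Lx b_def)
  \<comment> \<open>Symmetry moves \<open>A\<close> onto \<open>ones\<close>, where it agrees with
    \<open>D\<close>.\<close>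
  have ones_A: "ones \<bullet> (A *v z) = ones \<bullet> (D *v z)" for z
    by (metis D_def comm degree_matrix_mult_ones dot_lmul_matrix inner_commute sym
        transpose_matrix_vector)
  \<comment> \<open>Pairing the equation \<open>L x = b\<close> with \<open>ones\<close> isolates
    \<open>\<gamma>\<close>, because \<open>w\<close> is \<open>D\<close>-orthogonal to
    \<open>ones\<close>.\<close>
  have "ones \<bullet> (D *v b) = (1 - \<alpha>) * (ones \<bullet> (D *v x))"
    unfolding Lx'[symmetric] D_def degree_matrix_mult_L_matrix[OF inv]
    by (simp add: inner_diff_right ones_A D_def algebra_simps)
  moreover have "ones \<bullet> (D *v x) = \<gamma> * T"
    using T comm[of x ones] by (simp add: \<gamma>_def T_def coeff_D_eq)
  ultimately have \<gamma>: "(1 - \<alpha>) * \<gamma> = 1 - r"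
    using ones_b T by simp
  \<comment> \<open>The identity is checked after multiplication by the invertible
    \<open>D\<close>.\<close>
  have "D *v (L_matrix A \<alpha> *v ones) = D *v ((1 - \<alpha>) *\<^sub>R ones)"
    unfolding D_def degree_matrix_mult_L_matrix[OF inv]
    by (simp add: degree_matrix_mult_ones matrix_vector_mult_scaleR algebra_simps)
  then have L_ones: "L_matrix A \<alpha> *v ones = (1 - \<alpha>) *\<^sub>R ones"
    using inv unfolding D_def by (metis invertible_def matrix_vector_mul_assoc matrix_vector_mul_lid)
  have Lw: "L_matrix A \<alpha> *v w = b - (1 - r) *\<^sub>R ones"
    by (simp add: w_def matrix_vector_mult_diff_distrib matrix_vector_mult_scaleR Lx' L_ones
        \<gamma>[symmetric] mult.commute)
  have "(1 - \<alpha>)\<^sup>2 * (w \<bullet> (D *v w)) \<le> (L_matrix A \<alpha> *v w) \<bullet> (D *v (L_matrix A \<alpha> *v w))"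
    unfolding D_def using sym nonneg inv assms(4,5) by (intro L_matrix_norm_lower_bound) auto
  also have "\<dots> = b \<bullet> (D *v b) - 2 * (1 - r) * (ones \<bullet> (D *v b)) + (1 - r)\<^sup>2 * T"
    unfolding Lw using comm[of b ones]
    by (simp add: matrix_vector_mult_diff_distrib matrix_vector_mult_scaleR inner_diff_left
        inner_diff_right T_def power2_eq_square algebra_simps)
  also have "\<dots> = r * (1 - r) * T"
    unfolding ones_b b_b by (simp add: power2_eq_square algebra_simps)
  \<comment> \<open>The extra factor \<open>1 - r\<close> produces \<open>(1 - r)\<^sup>2\<close> on
    the right, which is \<open>(1 - \<alpha>)\<^sup>2 * \<gamma>\<^sup>2\<close>; the factor
    \<open>(1 - \<alpha>)\<^sup>2\<close> then cancels.\<close>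
  finally have "(1 - \<alpha>)\<^sup>2 * ((1 - r) * (w \<bullet> (D *v w))) \<le> (1 - r) * (r * (1 - r) * T)"
    using assms(6) by (simp add: r_def mult.left_commute)
  also have "\<dots> = (1 - \<alpha>)\<^sup>2 * (r * (\<gamma>\<^sup>2 * T))"
    unfolding \<gamma>[symmetric] by (simp add: power2_eq_square mult_ac)
  finally have "(1 - r) * (w \<bullet> (D *v w)) \<le> r * (\<gamma>\<^sup>2 * T)"
    using assms(5) by simp
  \<comment> \<open>Moving the \<open>r\<close> multiple of the \<open>w\<close> term to the right
    completes the squared \<open>D\<close>-norm of \<open>x\<close> there.\<close>
  then have bound: "w \<bullet> (D *v w) \<le> r * (\<gamma>\<^sup>2 * T + w \<bullet> (D *v w))"
    by (simp add: algebra_simps)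
  have "\<gamma> \<noteq> 0"
    using \<gamma> assms(6) by (auto simp: r_def)
  with T have "0 < \<gamma>\<^sup>2 * T" by simp
  have "w \<bullet> (D *v ones) = 0"
    using T by (simp add: w_def \<gamma>_def coeff_D_eq T_def inner_diff_left)
  then have "ones \<bullet> (D *v w) = 0" "w \<bullet> (D *v ones) = 0"
    using comm by metis+
  moreover have x_eq: "x = \<gamma> *\<^sub>R ones + w"
    by (simp add: w_def)
  ultimately have x_x: "x \<bullet> (D *v x) = \<gamma>\<^sup>2 * T + w \<bullet> (D *v w)"
    by (simp add: matrix_vector_right_distrib matrix_vector_mult_scaleR inner_add_left
        inner_add_right T_def power2_eq_square)
  have "(sin_D D x)\<^sup>2 = (w \<bullet> (D *v w)) / (x \<bullet> (D *v x))"
    unfolding sin_D_def \<gamma>_def[symmetric] w_def[symmetric] power_divide norm_D_power2[OF E] ..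
  also have "\<dots> \<le> r"
    unfolding x_x using bound \<open>0 < \<gamma>\<^sup>2 * T\<close> E[of w] by (simp add: divide_le_eq)
  finally show ?thesis by (simp add: D_def r_def)
qed

theorem proposition2:
  fixes A :: "real ^ 'n ^ 'n" and \<alpha> :: real and \<Omega> :: "'n set" and x :: "real ^ 'n"
  assumes "transpose A = A"
    and "\<And>i j. 0 \<le> A $ i $ j"
    and "invertible (degree_matrix A)"
    and "0 < \<alpha>" and "\<alpha> < 1"
    and "0 < rho A \<Omega>" and "rho A \<Omega> < 1"
    and "L_matrix A \<alpha> *v x = ones - ind_vec \<Omega>"
  shows "kappa_D (degree_matrix A) \<alpha> (L_matrix A \<alpha>) (ones - ind_vec \<Omega>)
    \<le> (if rho A \<Omega> \<le> (1 - \<alpha>)\<^sup>2 then sqrt 5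
        else sqrt (1 + (1 + \<alpha>)\<^sup>2 / (1 - \<alpha>)\<^sup>2))"
proof -
  define c s q where "c = cos_D (degree_matrix A) x" and "s = sin_D (degree_matrix A) x"
    and "q = (1 + \<alpha>)\<^sup>2 / (1 - \<alpha>)\<^sup>2"
  have "(THE y. L_matrix A \<alpha> *v y = ones - ind_vec \<Omega>) = x"
  proof (rule the_equality)
    show "L_matrix A \<alpha> *v x = ones - ind_vec \<Omega>" by (rule assms(8))
  next
    fix y assume "L_matrix A \<alpha> *v y = ones - ind_vec \<Omega>"
    with assms(8) have "L_matrix A \<alpha> *v y = L_matrix A \<alpha> *v x" by simp
    with assms(1-3) less_imp_le[OF assms(4)] assms(5) show "y = x"
      by (rule L_matrix_inj)
  qed
  then have kappa: "kappa_D (degree_matrix A) \<alpha> (L_matrix A \<alpha>) (ones - ind_vec \<Omega>)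
      = sqrt (c\<^sup>2 + s\<^sup>2 * q)"
    by (simp add: kappa_D_def c_def s_def q_def power_divide)
  have "x \<noteq> 0"
  proof
    assume "x = 0"
    with assms(8) have "ind_vec \<Omega> = (ones :: real ^ 'n)" by simp
    \<comment> \<open>Here \<open>rho\<close> is a quotient of equal terms: 1, or 0 if the
      denominator vanishes. Both values are excluded.\<close>
    with assms(6,7) show False by (simp add: rho_def split: if_splits)
  qed
  with assms(2,3) have cs: "c\<^sup>2 + s\<^sup>2 = 1"
    unfolding c_def s_def by (rule cos_D_sin_D_power2)
  then have c: "c\<^sup>2 \<le> 1" and s: "s\<^sup>2 \<le> 1"
    by (smt (verit) zero_le_power2)+
  have q: "0 \<le> q" by (simp add: q_def)
  show ?thesis
  proof (cases "rho A \<Omega> \<le> (1 - \<alpha>)\<^sup>2")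
    case True
    have "s\<^sup>2 \<le> rho A \<Omega>"
      unfolding s_def using assms(1-3) less_imp_le[OF assms(4)] assms(5,7,8)
      by (rule sin_D_power2_le_rho)
    with True have "s\<^sup>2 * q \<le> (1 - \<alpha>)\<^sup>2 * q"
      using q by (intro mult_right_mono) auto
    also have "\<dots> = (1 + \<alpha>)\<^sup>2"
      using assms(5) by (simp add: q_def)
    \<comment> \<open>Together with \<open>c\<^sup>2 \<le> 1\<close>, the value 4 gives the constant
      5 under the root.\<close>
    also have "\<dots> \<le> 2\<^sup>2"
      using assms(4,5) by (intro power_mono) auto
    finally show ?thesis
      using True c by (simp add: kappa)
  next
    case False
    \<comment> \<open>For larger \<open>rho\<close> the trivial bounds on sine and cosine
      suffice.\<close>
    have "s\<^sup>2 * q \<le> q"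
      using mult_right_mono[OF s q] by simp
    then have "sqrt (c\<^sup>2 + s\<^sup>2 * q) \<le> sqrt (1 + q)"
      using c by simp
    with False show ?thesis
      unfolding kappa q_def by simp
  qed
qed

end
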